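(* Let $G$ be a connected bipartite graph with at least two vertices that has a Hamiltonian path, and let $k \ge 2$. Then $F(G \,\square\, P_k) = \alpha(G \,\square\, P_k) - 1$, where $P_k$ is the path on $k$ vertices.
   Context: Peg solitaire on a graph: a configuration assigns to each vertex either a peg or a hole. If $x,y,z$ form a path $xyz$ with pegs at $x$ and $y$ and a hole at $z$, a jump $xyz$ removes the pegs at $x$ and $y$ and places a peg at $z$. A terminal state of a graph $G$ is the set of peg locations when no jump is available, reached by some sequence of jumps from a starting configuration with exactly one hole (and pegs on all other vertices). The fool's solitaire number $F(G)$ is the maximum size of a terminal state of $G$. $\alpha$ is the independence number. The cartesian product $G \,\square\, H$ has vertex set $V(G)\times V(H)$, two vertices being adjacent iff they are equal in one coordinate and adjacent in the other. *)

theory Defs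
  imports "Graph_Theory.Graph_Theory"
begin

text \<open>
  A finite simple graph is a pair digraph satisfying the locale \<^locale>\<open>pair_graph\<close>: each
  undirected edge is present as two opposite arcs, and there are no loops.
\<close>

definition path_graph :: "nat \<Rightarrow> nat pair_pre_digraph" where
  "path_graph k = \<lparr> pverts = {..<k},
     parcs = {(i, j). i < k \<and> j < k \<and> (j = Suc i \<or> i = Suc j)} \<rparr>"

definition cart_prod :: "'a pair_pre_digraph \<Rightarrow> 'b pair_pre_digraph \<Rightarrow> ('a \<times> 'b) pair_pre_digraph"
    (infixl \<open>\<box>\<close> 70) where
  "G \<box> H = \<lparr> pverts = pverts G \<times> pverts H,
     parcs = {((u, v), (u', v')).
       (u = u' \<and> u \<in> pverts G \<and> (v, v') \<in> parcs H) \<or>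
       (v = v' \<and> v \<in> pverts H \<and> (u, u') \<in> parcs G)} \<rparr>"

definition bipartite :: "'a pair_pre_digraph \<Rightarrow> bool" where
  "bipartite G \<longleftrightarrow> (\<exists>A B. pverts G = A \<union> B \<and> A \<inter> B = {} \<and> parcs G \<subseteq> A \<times> B \<union> B \<times> A)"

definition has_hamiltonian_path :: "'a pair_pre_digraph \<Rightarrow> bool" where
  "has_hamiltonian_path G \<longleftrightarrow> (\<exists>p. vpath p (with_proj G) \<and> set p = pverts G)"

definition independent_set :: "'a pair_pre_digraph \<Rightarrow> 'a set \<Rightarrow> bool" where
  "independent_set G S \<longleftrightarrow> S \<subseteq> pverts G \<and> (\<forall>u\<in>S. \<forall>v\<in>S. (u, v) \<notin> parcs G)"

definition independence_number :: "'a pair_pre_digraph \<Rightarrow> nat" where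
  "independence_number G = Max {card S | S. independent_set G S}"

text \<open>A configuration is represented by the set of vertices carrying a peg.\<close>

definition jump :: "'a pair_pre_digraph \<Rightarrow> 'a set \<Rightarrow> 'a set \<Rightarrow> bool" where
  "jump G S S' \<longleftrightarrow> (\<exists>x y z. vpath [x, y, z] (with_proj G) \<and>
     x \<in> S \<and> y \<in> S \<and> z \<notin> S \<and> S' = insert z (S - {x, y}))"

definition terminal_state :: "'a pair_pre_digraph \<Rightarrow> 'a set \<Rightarrow> bool" where
  "terminal_state G T \<longleftrightarrow>
     (\<exists>h\<in>pverts G. (jump G)\<^sup>*\<^sup>* (pverts G - {h}) T) \<and> (\<nexists>T'. jump G T T')"

definition fools_solitaire_number :: "'a pair_pre_digraph \<Rightarrow> nat" where
  "fools_solitaire_number G = Max {card T | T. terminal_state G T}"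

lemma pair_graph_path_graph: "pair_graph (path_graph k)"
proof
  show "finite (parcs (path_graph k))"
    by (rule finite_subset[of _ "{..<k} \<times> {..<k}"]) (auto simp: path_graph_def)
qed (auto simp: path_graph_def symmetric_def sym_def)

lemma pair_graph_cart_prod:
  assumes "pair_graph G" "pair_graph H"
  shows "pair_graph (G \<box> H)"
proof -
  interpret G: pair_graph G by fact
  interpret H: pair_graph H by fact
  have sG: "(v, u) \<in> parcs G" if "(u, v) \<in> parcs G" for u v
    using G.pair_sym_arcs that by (auto simp: symmetric_def sym_def)
  have sH: "(v, u) \<in> parcs H" if "(u, v) \<in> parcs H" for u v
    using H.pair_sym_arcs that by (auto simp: symmetric_def sym_def)
  have sub: "parcs (G \<box> H) \<subseteq> pverts (G \<box> H) \<times> pverts (G \<box> H)"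
    by (auto simp: cart_prod_def dest: G.wellformed' H.wellformed')
  have fin: "finite (pverts (G \<box> H))"
    by (simp add: cart_prod_def G.pair_finite_verts H.pair_finite_verts)
  show ?thesis
  proof
    show "finite (parcs (G \<box> H))"
      using finite_subset[OF sub] fin by blast
    show "symmetric (with_proj (G \<box> H))"
      by (auto simp: symmetric_def sym_def cart_prod_def intro: sG sH)
  qed (use fin in \<open>auto simp: cart_prod_def dest: G.pair_no_loops H.pair_no_loops G.wellformed' H.wellformed'\<close>)
qed

text \<open>The sets whose maxima are taken above are finite and nonempty.\<close>

lemma independent_cards:
  assumes "finite (pverts G)"
  shows "finite {card S | S. independent_set G S}" "{card S | S. independent_set G S} \<noteq> {}"
proof -
  have "{card S | S. independent_set G S} \<subseteq> card ` Pow (pverts G)"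
    by (auto simp: independent_set_def)
  then show "finite {card S | S. independent_set G S}"
    using assms by (meson finite_Pow_iff finite_imageI finite_subset)
  have "independent_set G {}" by (simp add: independent_set_def)
  then show "{card S | S. independent_set G S} \<noteq> {}" by blast
qed

lemma jump_subset:
  assumes "jump G S S'" "S \<subseteq> pverts G"
  shows "S' \<subseteq> pverts G"
  using assms by (auto simp: jump_def vpath_def vwalk_def)

lemma jump_card:
  assumes "jump G S S'" "finite S"
  shows "card S' < card S"
proof -
  obtain x y z where *: "x \<in> S" "y \<in> S" "x \<noteq> y" "z \<notin> S" "S' = insert z (S - {x, y})"
    using assms(1) by (auto simp: jump_def vpath_def)
  have "card {x, y} \<le> card S" using * assms(2) by (intro card_mono) auto
  with * assms(2) show ?thesis by (simp add: card_Diff_subset)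
qed

lemma jumps_subset: "(jump G)\<^sup>*\<^sup>* S T \<Longrightarrow> S \<subseteq> pverts G \<Longrightarrow> T \<subseteq> pverts G"
  by (induction rule: rtranclp_induct) (auto dest: jump_subset)

lemma jumps_terminate:
  "finite S \<Longrightarrow> \<exists>T. (jump G)\<^sup>*\<^sup>* S T \<and> (\<nexists>T'. jump G T T')"
proof (induction "card S" arbitrary: S rule: less_induct)
  case less
  show ?case
  proof (cases "\<exists>S'. jump G S S'")
    case True
    then obtain S' where S': "jump G S S'" by blast
    then have "finite S'" using less.prems by (auto simp: jump_def)
    with less.hyps jump_card[OF S' less.prems] S' show ?thesis
      by (meson converse_rtranclp_into_rtranclp)
  qed auto
qed

lemma terminal_cards:
  assumes "finite (pverts G)" "pverts G \<noteq> {}"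
  shows "finite {card T | T. terminal_state G T}" "{card T | T. terminal_state G T} \<noteq> {}"
proof -
  have "{card T | T. terminal_state G T} \<subseteq> card ` Pow (pverts G)"
    by (auto simp: terminal_state_def dest!: jumps_subset)
  then show "finite {card T | T. terminal_state G T}"
    using assms by (meson finite_Pow_iff finite_imageI finite_subset)
  obtain h where "h \<in> pverts G" using assms by blast
  then show "{card T | T. terminal_state G T} \<noteq> {}"
    using jumps_terminate[of "pverts G - {h}" G] assms by (auto simp: terminal_state_def)
qed

end

theory Submission
  imports Defs
begin

text \<open>
  A boustrophedon walk turns a Hamiltonian path of \<open>G\<close> into a Hamiltonian path \<open>q 0, q 1, \<dots>\<close> of
  \<open>G \<box> P\<^sub>k\<close>, whose even-indexed vertices form a maximum independent set. Playing backwards from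
  the even-indexed vertices without \<open>q 0\<close> (so that holes behave as pegs), the hole at \<open>q 0\<close> walks
  along the path two steps at a time and consumes the holes at all odd-indexed vertices; if the last
  vertex is one of them, it is consumed by stepping to a second neighbour of that vertex. Hence
  \<open>\<alpha> - 1\<close> is attained. Conversely, a terminal state is independent, and a maximum independent set
  of \<open>G \<box> P\<^sub>k\<close> is a colour class, hence meets every edge; but the last jump \<open>xyz\<close> leaves
  the edge \<open>xy\<close> empty.
\<close>

section \<open>Counting by pairs\<close>

text \<open>Pigeonhole: every pair contributes at most one element, so equality leaves no pair out.
  The clause \<open>f i \<noteq> g i\<close> admits degenerate pairs, needed for the unmatched last
  vertex of a path with an odd number of vertices.\<close>

lemma card_le_pairs:
  assumes "finite I" "T \<subseteq> (\<Union>i\<in>I. {f i, g i})" "\<And>i. i \<in> I \<Longrightarrow> \<not> (f i \<in> T \<and> g i \<in> T \<and> f i \<noteq> g i)"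
  shows "card T \<le> card I"
    and "card T = card I \<Longrightarrow> i \<in> I \<Longrightarrow> f i \<in> T \<or> g i \<in> T"
proof -
  define J where "J = {i \<in> I. f i \<in> T \<or> g i \<in> T}"
  define h where "h i = (if f i \<in> T then f i else g i)" for i
  have "T \<subseteq> h ` J"
  proof
    fix x assume "x \<in> T"
    with assms(2) obtain i where "i \<in> I" "x = f i \<or> x = g i" by auto
    with \<open>x \<in> T\<close> assms(3)[of i] have "x = h i" "i \<in> J" by (auto simp: h_def J_def)
    then show "x \<in> h ` J" by blast
  qed
  moreover have "finite J" "J \<subseteq> I" using assms(1) by (auto simp: J_def)
  ultimately have TJ: "card T \<le> card J" by (meson surj_card_le)
  also have "\<dots> \<le> card I" using \<open>J \<subseteq> I\<close> assms(1) by (rule card_mono[rotated])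
  finally show "card T \<le> card I" .
  assume "card T = card I" "i \<in> I"
  with TJ have "J = I" using \<open>J \<subseteq> I\<close> assms(1) by (metis card_seteq)
  with \<open>i \<in> I\<close> show "f i \<in> T \<or> g i \<in> T" by (auto simp: J_def)
qed

section \<open>Bipartite graphs traversed by a Hamiltonian path\<close>

text \<open>Separates the solitaire argument from the geometry of the product. Numbering the
  vertices along the path turns the 2-colouring into the parity of the index.\<close>

locale bipartite_hamiltonian =
  fixes H :: "'a pair_pre_digraph" and c :: "'a \<Rightarrow> bool" and q :: "nat \<Rightarrow> 'a" and N :: nat
  assumes pair_graph: "pair_graph H"
    and colour: "(u, v) \<in> parcs H \<Longrightarrow> c u \<noteq> c v"
    and bij_q: "bij_betw q {..<N} (pverts H)"
    and path: "Suc t < N \<Longrightarrow> (q t, q (Suc t)) \<in> parcs H"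
begin

sublocale pair_graph H by (rule pair_graph)

lemma arc_verts: "(u, v) \<in> parcs H \<Longrightarrow> u \<in> pverts H \<and> v \<in> pverts H"
  by (auto dest: wellformed')

lemma arc_sym: "(u, v) \<in> parcs H \<Longrightarrow> (v, u) \<in> parcs H"
  using pair_sym_arcs by (auto simp: symmetric_def sym_def)

lemma arc_neq: "(u, v) \<in> parcs H \<Longrightarrow> u \<noteq> v"
  using colour by blast

lemma jump_iff: "jump H S S' \<longleftrightarrow> (\<exists>x y z. (x, y) \<in> parcs H \<and> (y, z) \<in> parcs H \<and> x \<noteq> z \<and>
     x \<in> S \<and> y \<in> S \<and> z \<notin> S \<and> S' = insert z (S - {x, y}))"
proof -
  have "vpath [x, y, z] (with_proj H) \<longleftrightarrow> (x, y) \<in> parcs H \<and> (y, z) \<in> parcs H \<and> x \<noteq> z" for x y z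
    by (auto simp: vpath_def vwalk_def dest: arc_verts arc_neq)
  then show ?thesis unfolding jump_def by blast
qed

lemma q_in: "t < N \<Longrightarrow> q t \<in> pverts H"
  using bij_q by (auto simp: bij_betw_def)

lemma q_eq: "s < N \<Longrightarrow> t < N \<Longrightarrow> q s = q t \<longleftrightarrow> s = t"
  using bij_q by (auto simp: bij_betw_def inj_on_def)

lemma q_surj: "v \<in> pverts H \<Longrightarrow> \<exists>t<N. v = q t"
  using bij_q by (auto simp: bij_betw_def)

lemma card_verts: "card (pverts H) = N"
  using bij_betw_same_card[OF bij_q] by simp

lemma colour_q: "t < N \<Longrightarrow> c (q t) \<longleftrightarrow> (even t \<longleftrightarrow> c (q 0))"
proof (induction t)
  case (Suc t)
  then show ?case using colour[OF path[of t]] by auto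
qed simp

lemma arc_parity: "(q s, q t) \<in> parcs H \<Longrightarrow> s < N \<Longrightarrow> t < N \<Longrightarrow> even s \<noteq> even t"
  using colour[of "q s" "q t"] colour_q[of s] colour_q[of t] by auto

section \<open>Maximum independent sets\<close>

lemma indep_even:
  assumes "S \<subseteq> q ` {t. t < N \<and> even t}"
  shows "independent_set H S"
proof -
  have "(u, v) \<notin> parcs H" if "u \<in> S" "v \<in> S" for u v
    using that assms arc_parity by blast
  then show ?thesis using assms q_in by (auto simp: independent_set_def)
qed

lemma card_even: "card (q ` {t. t < N \<and> even t}) = (N + 1) div 2"
proof -
  have "{t. t < N \<and> even t} = (\<lambda>i. 2 * i) ` {..<(N + 1) div 2}"
    by (auto simp: image_iff elim!: evenE)
  then have "card {t. t < N \<and> even t} = (N + 1) div 2"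
    by (simp add: card_image inj_on_def)
  moreover have "card (q ` {t. t < N \<and> even t}) = card {t. t < N \<and> even t}"
    by (rule card_image) (auto simp: inj_on_def q_eq)
  ultimately show ?thesis by simp
qed

text \<open>Consecutive path vertices are adjacent, so pairing them off bounds
  \<open>card T\<close>. For odd \<open>N\<close> the \<open>min\<close> collapses the last pair to
  the single vertex \<open>q (N - 1)\<close>.\<close>

lemma independent_card_le:
  assumes "independent_set H T"
  shows "card T \<le> (N + 1) div 2"
    and "card T = (N + 1) div 2 \<Longrightarrow> i < (N + 1) div 2 \<Longrightarrow>
           q (2 * i) \<in> T \<or> q (min (2 * i + 1) (N - 1)) \<in> T"
proof -
  let ?I = "{..<(N + 1) div 2}"
  have sub: "T \<subseteq> (\<Union>i\<in>?I. {q (2 * i), q (min (2 * i + 1) (N - 1))})"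
  proof
    fix v assume "v \<in> T"
    then obtain t where t: "t < N" "v = q t" using assms q_surj by (auto simp: independent_set_def)
    define i where "i = t div 2"
    have "i \<in> ?I" "t = 2 * i \<or> t = min (2 * i + 1) (N - 1)"
      using t(1) by (auto simp: i_def)
    then show "v \<in> (\<Union>i\<in>?I. {q (2 * i), q (min (2 * i + 1) (N - 1))})"
      using t(2) by blast
  qed
  have pair: "\<not> (q (2 * i) \<in> T \<and> q (min (2 * i + 1) (N - 1)) \<in> T \<and>
      q (2 * i) \<noteq> q (min (2 * i + 1) (N - 1)))" if "i \<in> ?I" for i
  proof (cases "Suc (2 * i) < N")
    case True
    then show ?thesis using path[of "2 * i"] assms by (auto simp: independent_set_def min_def)
  next
    case False
    with that have "N - 1 = 2 * i" by auto
    then show ?thesis by simp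
  qed
  show "card T \<le> (N + 1) div 2"
    using card_le_pairs(1)[OF _ sub pair] by simp
  show "q (2 * i) \<in> T \<or> q (min (2 * i + 1) (N - 1)) \<in> T"
    if "card T = (N + 1) div 2" "i < (N + 1) div 2"
    using card_le_pairs(2)[OF _ sub pair, of i] that by simp
qed

lemma independence_number_eq: "independence_number H = (N + 1) div 2"
  unfolding independence_number_def
proof (rule Max_eqI)
  show "finite {card S |S. independent_set H S}"
    by (rule independent_cards) (rule pair_finite_verts)
  show "(N + 1) div 2 \<in> {card S |S. independent_set H S}"
    using card_even indep_even[OF order_refl] by force
qed (use independent_card_le in auto)

text \<open>Alternation makes \<open>T\<close> one of the two parity classes of the path, and every
  edge has an endpoint in each of them.\<close>

lemma alternating_meets_arcs:
  assumes alt: "\<And>t. Suc t < N \<Longrightarrow> q t \<in> T \<longleftrightarrow> q (Suc t) \<notin> T" and "(x, y) \<in> parcs H"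
  shows "x \<in> T \<or> y \<in> T"
proof -
  have *: "q t \<in> T \<longleftrightarrow> (even t \<longleftrightarrow> q 0 \<in> T)" if "t < N" for t
    using that by (induction t) (auto dest: alt)
  obtain s t where "s < N" "t < N" "x = q s" "y = q t"
    using arc_verts[OF assms(2)] q_surj by meson
  then show ?thesis using arc_parity[of s t] assms(2) *[of s] *[of t] by auto
qed

text \<open>The last vertex is a pair by itself and must lie in \<open>T\<close>. Going backwards,
  \<open>q (2 * i + 2)\<close> in \<open>T\<close> excludes \<open>q (2 * i + 1)\<close>, so the
  pair of the latter is met in \<open>q (2 * i)\<close>.\<close>

lemma odd_maximum_alternating:
  assumes "odd N" "independent_set H T" "card T = (N + 1) div 2" "Suc t < N"
  shows "q t \<in> T \<longleftrightarrow> q (Suc t) \<notin> T"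
proof -
  have notboth: "\<not> (q s \<in> T \<and> q (Suc s) \<in> T)" if "Suc s < N" for s
    using path[OF that] assms(2) by (auto simp: independent_set_def)
  obtain m where m: "N = 2 * m + 1" using assms(1) by (elim oddE)
  have even_in: "q (2 * i) \<in> T" if "i \<le> m" for i
    using that
  proof (induction rule: inc_induct)
    case base
    show ?case using independent_card_le(2)[OF assms(2,3), of m] m by auto
  next
    case (step i)
    then show ?case using independent_card_le(2)[OF assms(2,3), of i] m notboth[of "2 * i + 1"]
      by (auto simp: min_def split: if_splits)
  qed
  show ?thesis
  proof (cases "even t")
    case True
    then obtain i where "t = 2 * i" by (elim evenE)
    then show ?thesis using even_in[of i] notboth[OF assms(4)] assms(4) m by auto
  next
    case False
    then obtain i where "t = 2 * i + 1" by (elim oddE)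
    then show ?thesis using even_in[of "Suc i"] notboth[OF assms(4)] assms(4) m by auto
  qed
qed

section \<open>Terminal states: the upper bound\<close>

lemma reachable_proper:
  assumes "(jump H)\<^sup>*\<^sup>* (pverts H - {h}) T" "h \<in> pverts H"
  shows "T \<subset> pverts H"
proof -
  have "finite T \<and> card T < N" using assms(1)
  proof (induction rule: rtranclp_induct)
    case base
    then show ?case
      using assms(2) card_verts pair_finite_verts by (metis card_Diff1_less finite_Diff)
  next
    case (step S S')
    then show ?case using jump_card[of H S S'] by (auto simp: jump_def)
  qed
  moreover have "T \<subseteq> pverts H" using jumps_subset[OF assms(1)] by auto
  ultimately show ?thesis using card_verts by auto
qed

text \<open>If both ends of an edge \<open>xy\<close> carry pegs, a hole next to \<open>y\<close>
  would permit a jump; so all neighbours of \<open>y\<close> carry pegs. The same then holds for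
  each neighbour, and pegs would fill the whole Hamiltonian path, although some hole always
  remains.\<close>

lemma terminal_independent:
  assumes "terminal_state H T"
  shows "independent_set H T"
proof -
  obtain h where h: "h \<in> pverts H" "(jump H)\<^sup>*\<^sup>* (pverts H - {h}) T"
    and nojump: "\<And>T'. \<not> jump H T T'" using assms by (auto simp: terminal_state_def)
  have proper: "T \<subset> pverts H" using reachable_proper h by blast
  define P where "P v \<longleftrightarrow> v \<in> T \<and> (\<forall>w. (v, w) \<in> parcs H \<longrightarrow> w \<in> T)" for v
  have P_arc: "P y" if "(x, y) \<in> parcs H" "x \<in> T" "y \<in> T" for x y
    using that nojump unfolding jump_iff P_def by metis
  have False if xy: "(x, y) \<in> parcs H" "x \<in> T" "y \<in> T" for x y
  proof -
    obtain s where s: "s < N" "y = q s" using q_surj[of y] arc_verts[OF xy(1)] by blast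
    \<comment> \<open>The edge may lie anywhere on the path, so \<open>P\<close> has to spread in
      both directions.\<close>
    have up: "P (q t) \<Longrightarrow> P (q (Suc t))" if "Suc t < N" for t
      using P_arc[OF path[OF that]] path[OF that] unfolding P_def by blast
    have down: "P (q (Suc t)) \<Longrightarrow> P (q t)" if "Suc t < N" for t
      using P_arc[OF arc_sym[OF path[OF that]]] arc_sym[OF path[OF that]] unfolding P_def by blast
    have P0: "P (q t) \<longleftrightarrow> P (q 0)" if "t < N" for t
      using that
    proof (induction t)
      case (Suc t)
      then show ?case using up[OF Suc.prems] down[OF Suc.prems] by auto
    qed simp
    have "P (q s)" using P_arc xy s by blast
    then have "P (q 0)" using P0[OF s(1)] by blast
    then have "q t \<in> T" if "t < N" for t using P0[OF that] unfolding P_def by blast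
    then show False using proper q_surj by blast
  qed
  then show ?thesis using proper by (auto simp: independent_set_def)
qed

lemma terminal_card_less:
  assumes "terminal_state H T" and N: "N \<ge> 4"
    and rigid: "\<And>x y. independent_set H T \<Longrightarrow> card T = (N + 1) div 2 \<Longrightarrow>
      (x, y) \<in> parcs H \<Longrightarrow> x \<in> T \<or> y \<in> T"
  shows "card T \<le> (N + 1) div 2 - 1"
proof (rule ccontr)
  assume "\<not> ?thesis"
  moreover have ind: "independent_set H T" using terminal_independent assms(1) by blast
  ultimately have card: "card T = (N + 1) div 2" using independent_card_le(1)[of T] by linarith
  obtain h where h: "h \<in> pverts H" "(jump H)\<^sup>*\<^sup>* (pverts H - {h}) T"
    using assms(1) by (auto simp: terminal_state_def)
  from h(2) show False
  proof (cases rule: rtranclp.cases)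
    case rtrancl_refl
    \<comment> \<open>Without any jump \<open>N - 1\<close> pegs remain, more than
      \<open>(N + 1) div 2\<close> because \<open>N \<ge> 4\<close>.\<close>
    then have "card T = N - 1" using h(1) card_verts pair_finite_verts by simp
    then show False using card N by linarith
  next
    case (rtrancl_into_rtrancl S)
    then obtain x y z where "(x, y) \<in> parcs H" "(y, z) \<in> parcs H" "x \<noteq> z" "T = insert z (S - {x, y})"
      by (auto simp: jump_iff)
    then show False using rigid[OF ind card] arc_neq by fastforce
  qed
qed

section \<open>A terminal state attaining the bound\<close>

text \<open>For even \<open>N\<close> the last vertex has odd index and nothing follows it on the
  path; \<open>last\<close> supplies a vertex on which the jump over it can land.\<close>

lemma terminal_even:
  assumes N: "N \<ge> 2"
    and last: "even N \<Longrightarrow> \<exists>w. (q (N - 1), w) \<in> parcs H \<and> w \<noteq> q (N - 2)"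
  shows "terminal_state H (q ` {t. t < N \<and> even t} - {q 0})"
proof -
  \<comment> \<open>The game read backwards: play descends from \<open>S (Suc i)\<close> to
    \<open>S i\<close> and ends in the target \<open>S 0\<close>.\<close>
  define S where "S i = pverts H - insert (q (2 * i)) (q ` {t. t < N \<and> odd t \<and> 2 * i < t})" for i
  have step: "jump H (S (Suc i)) (S i)" if i: "2 * i + 2 < N" for i
    unfolding jump_iff
  proof (intro exI conjI)
    show "(q (2 * i), q (2 * i + 1)) \<in> parcs H" "(q (2 * i + 1), q (2 * i + 2)) \<in> parcs H"
      using path[of "2 * i"] path[of "2 * i + 1"] i by auto
    \<comment> \<open>The jumped-over vertex is the only odd-indexed hole that \<open>S i\<close>
      has and \<open>S (Suc i)\<close> lacks.\<close>
    have split: "{t. t < N \<and> odd t \<and> 2 * i < t} = insert (2 * i + 1) {t. t < N \<and> odd t \<and> 2 * Suc i < t}"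
      using i by auto presburger
    show "q (2 * i) \<noteq> q (2 * i + 2)" using i by (simp add: q_eq)
    show "q (2 * i) \<in> S (Suc i)" "q (2 * i + 1) \<in> S (Suc i)" "q (2 * i + 2) \<notin> S (Suc i)"
      using i by (auto simp: S_def q_in q_eq)
    show "S i = insert (q (2 * i + 2)) (S (Suc i) - {q (2 * i), q (2 * i + 1)})"
      unfolding S_def split using i by (auto simp: q_in q_eq)
  qed
  have reach: "(jump H)\<^sup>*\<^sup>* (S i) (S 0)" if "2 * i < N" for i
    using that
  proof (induction i)
    case (Suc i)
    then show ?case using step[of i] by (auto intro: converse_rtranclp_into_rtranclp)
  qed simp
  have S0: "S 0 = q ` {t. t < N \<and> even t} - {q 0}"
    using N by (auto simp: S_def q_in q_eq dest!: q_surj)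
  have "\<exists>h\<in>pverts H. (jump H)\<^sup>*\<^sup>* (pverts H - {h}) (S 0)"
  proof (cases "even N")
    case False
    then obtain m where m: "N = 2 * m + 1" by (elim oddE)
    \<comment> \<open>No odd index exceeds \<open>2 * m\<close>, so \<open>S m\<close> is itself a
      starting configuration.\<close>
    have "S m = pverts H - {q (2 * m)}" using m by (auto simp: S_def)
    then show ?thesis using reach[of m] q_in[of "2 * m"] m by auto
  next
    case True
    then obtain m where m: "N = 2 * Suc m" using N by (metis evenE not0_implies_Suc mult_0_right not_numeral_le_zero)
    \<comment> \<open>Here \<open>S m\<close> has two holes, the last two path vertices. It arises
      from the configuration with sole hole \<open>w\<close> by jumping over the last vertex into
      \<open>w\<close>.\<close>
    obtain w where w: "(q (2 * m + 1), w) \<in> parcs H" "w \<noteq> q (2 * m)" using last[OF True] m by auto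
    have arc: "(q (2 * m), q (2 * m + 1)) \<in> parcs H" using path[of "2 * m"] m by simp
    have "{t. t < N \<and> odd t \<and> 2 * m < t} = {2 * m + 1}" using m by (auto elim!: oddE)
    then have "S m = insert w (pverts H - {w} - {q (2 * m), q (2 * m + 1)})"
      using w arc_verts[OF w(1)] arc_neq[OF w(1)] by (auto simp: S_def)
    then have "jump H (pverts H - {w}) (S m)"
      unfolding jump_iff using arc w arc_neq[OF w(1)] arc_verts[OF arc] by blast
    then show ?thesis
      using reach[of m] arc_verts[OF w(1)] m by (auto intro: converse_rtranclp_into_rtranclp)
  qed
  moreover have "independent_set H (S 0)" unfolding S0 by (rule indep_even) auto
  then have "\<nexists>T'. jump H (S 0) T'" unfolding jump_iff independent_set_def by blast
  ultimately show ?thesis unfolding terminal_state_def S0 by blast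
qed

text \<open>Rigidity is automatic for odd \<open>N\<close>. For even \<open>N\<close> it can fail:
  \<open>{0, 3}\<close> is a maximum independent set of \<open>path_graph 4\<close> that does not
  alternate. Hence the hypothesis \<open>rigid\<close>.\<close>

theorem fools_solitaire_number_eq:
  assumes N: "N \<ge> 4"
    and last: "even N \<Longrightarrow> \<exists>w. (q (N - 1), w) \<in> parcs H \<and> w \<noteq> q (N - 2)"
    and rigid: "\<And>T t. even N \<Longrightarrow> independent_set H T \<Longrightarrow> 2 * card T = N \<Longrightarrow> Suc t < N \<Longrightarrow>
      q t \<in> T \<longleftrightarrow> q (Suc t) \<notin> T"
  shows "fools_solitaire_number H = independence_number H - 1"
  unfolding independence_number_eq fools_solitaire_number_def
proof (rule Max_eqI)
  have "pverts H \<noteq> {}" using N card_verts by auto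
  then show "finite {card T |T. terminal_state H T}"
    using terminal_cards(1) pair_finite_verts by blast
  have "card (q ` {t. t < N \<and> even t} - {q 0}) = (N + 1) div 2 - 1"
    using N card_even by (subst card_Diff_singleton) auto
  then show "(N + 1) div 2 - 1 \<in> {card T |T. terminal_state H T}"
    using terminal_even[OF _ last] N by force
  fix s assume "s \<in> {card T |T. terminal_state H T}"
  then obtain T where T: "terminal_state H T" "s = card T" by blast
  have "q t \<in> T \<longleftrightarrow> q (Suc t) \<notin> T"
    if "independent_set H T" "card T = (N + 1) div 2" "Suc t < N" for t
    using odd_maximum_alternating rigid that by (cases "even N") auto
  then show "s \<le> (N + 1) div 2 - 1"
    using terminal_card_less[OF T(1) N] alternating_meets_arcs[of T] T(2) by blast
qed

end

section \<open>Alternation in grids\<close>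

lemma less_even_cases:
  fixes j k :: nat
  assumes "j < k" "even k"
  shows "\<exists>l<k div 2. j = 2 * l \<or> j = 2 * l + 1"
  using assms by (intro exI[of _ "j div 2"]) presburger

text \<open>Neighbouring rungs span a 4-cycle on which only a diagonal can be chosen, so lines
  \<open>i\<close> and \<open>Suc i\<close> are complementary. As \<open>n \<ge> 2\<close>, every
  line has a complementary one, where two consecutive gaps would become two adjacent elements. Using
  a predicate of two indices lets the coordinates be swapped.\<close>

lemma ladder_alternating:
  fixes P :: "nat \<Rightarrow> nat \<Rightarrow> bool"
  assumes h: "\<And>i j. Suc i < n \<Longrightarrow> j < k \<Longrightarrow> \<not> (P i j \<and> P (Suc i) j)"
    and v: "\<And>i j. i < n \<Longrightarrow> Suc j < k \<Longrightarrow> \<not> (P i j \<and> P i (Suc j))"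
    and rung: "\<And>i j. i < n \<Longrightarrow> j < k div 2 \<Longrightarrow> P i (2 * j) \<or> P i (2 * j + 1)"
    and "even k" "n \<ge> 2"
  shows "Suc i < n \<Longrightarrow> j < k \<Longrightarrow> P i j \<longleftrightarrow> \<not> P (Suc i) j"
    and "i < n \<Longrightarrow> Suc j < k \<Longrightarrow> P i j \<longleftrightarrow> \<not> P i (Suc j)"
proof -
  have row: "P i j \<longleftrightarrow> \<not> P (Suc i) j" if "Suc i < n" "j < k" for i j
  proof -
    define l where "l = j div 2"
    have l: "2 * l + 1 < k" "l < k div 2" "j = 2 * l \<or> j = 2 * l + 1"
      using that \<open>even k\<close> unfolding l_def by presburger+
    then show ?thesis
      using that h[of i "2 * l"] h[of i "2 * l + 1"] v[of i "2 * l"] v[of "Suc i" "2 * l"]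
        rung[of i l] rung[of "Suc i" l] by auto
  qed
  have opp: "\<exists>i'<n. \<forall>j<k. P i j \<longleftrightarrow> \<not> P i' j" if "i < n" for i
  proof (cases "Suc i < n")
    case True
    then show ?thesis using row by blast
  next
    case False
    then obtain i' where "i = Suc i'" using \<open>n \<ge> 2\<close> that by (cases i) auto
    then show ?thesis using row[of i'] that by (metis Suc_lessD)
  qed
  show "P i j \<longleftrightarrow> \<not> P (Suc i) j" if "Suc i < n" "j < k" using row that .
  show "P i j \<longleftrightarrow> \<not> P i (Suc j)" if "i < n" "Suc j < k"
    using opp[OF that(1)] v[OF that] v[OF _ that(2)] that(2) by (metis Suc_lessD)
qed

section \<open>Paths by index and the boustrophedon walk\<close>

lemma vwalk_nth_arc: "vwalk p G \<Longrightarrow> Suc i < length p \<Longrightarrow> (p ! i, p ! Suc i) \<in> arcs_ends G"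
proof -
  have "(p ! i, p ! Suc i) \<in> set (vwalk_arcs p)" if "Suc i < length p"
    using that by (induction p arbitrary: i rule: vwalk_arcs.induct) (auto simp: nth_Cons split: nat.splits)
  then show "vwalk p G \<Longrightarrow> Suc i < length p \<Longrightarrow> (p ! i, p ! Suc i) \<in> arcs_ends G"
    by (auto simp: vwalk_def)
qed

text \<open>Column and row at step \<open>t\<close> of the boustrophedon walk through a grid with rows of length \<open>n\<close>.\<close>

definition snake :: "nat \<Rightarrow> nat \<Rightarrow> nat \<times> nat" where
  "snake n t = (if even (t div n) then t mod n else n - 1 - t mod n, t div n)"

lemma snake_bij:
  assumes "n > 0"
  shows "bij_betw (snake n) {..<n * k} ({..<n} \<times> {..<k})"
proof -
  have img: "snake n ` {..<n * k} = {..<n} \<times> {..<k}"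
  proof (intro equalityI subsetI)
    fix x assume "x \<in> {..<n} \<times> {..<k}"
    then obtain i j where x: "x = (i, j)" "i < n" "j < k" by auto
    \<comment> \<open>Odd rows are walked backwards; the reflection is its own inverse and recovers
      the offset from the column.\<close>
    define r where "r = (if even j then i else n - 1 - i)"
    have r: "r < n" using x by (auto simp: r_def)
    have "j * n + r < (j + 1) * n" using r by simp
    also have "\<dots> \<le> n * k" using x(3) by (subst mult.commute[of n]) (intro mult_le_mono1, simp)
    finally have "j * n + r \<in> {..<n * k}" by simp
    moreover have "snake n (j * n + r) = x"
    proof -
      have "snake n (j * n + r) = (if even j then r else n - 1 - r, j)"
        using r by (simp add: snake_def)
      then show ?thesis using x by (auto simp: r_def)
    qed
    ultimately show "x \<in> snake n ` {..<n * k}" by blast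
  next
    fix x assume "x \<in> snake n ` {..<n * k}"
    then show "x \<in> {..<n} \<times> {..<k}"
      using assms by (auto simp: snake_def less_mult_imp_div_less mult.commute)
  qed
  moreover have "inj_on (snake n) {..<n * k}"
    by (rule eq_card_imp_inj_on) (auto simp: img)
  ultimately show ?thesis by (simp add: bij_betw_def)
qed

text \<open>Rows are run in either direction, hence only the unordered pair in the first case. At
  the end of a row the walk changes rows within the same column.\<close>

lemma snake_step:
  assumes "n > 0" and "Suc t < n * k"
  obtains i j where "Suc i < n" "j < k" "{snake n t, snake n (Suc t)} = {(i, j), (Suc i, j)}"
  | i j where "i < n" "Suc j < k" "snake n t = (i, j)" "snake n (Suc t) = (i, Suc j)"
proof (cases "Suc (t mod n) = n")
  case True
  have *: "Suc t div n = Suc (t div n)" "Suc t mod n = 0"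
    using True by (auto simp: div_Suc mod_Suc)
  then have "Suc (t div n) < k" using assms less_mult_imp_div_less by (metis mult.commute)
  with * True show ?thesis using assms
    by (intro that(2)[of "fst (snake n t)" "t div n"]) (auto simp: snake_def)
next
  case False
  then have *: "Suc t div n = t div n" "Suc t mod n = Suc (t mod n)"
    by (auto simp: div_Suc mod_Suc)
  have lt: "Suc (t mod n) < n" using False assms(1) by (metis Suc_lessI mod_less_divisor)
  have k: "t div n < k" using assms less_mult_imp_div_less by (metis mult.commute Suc_lessD)
  show ?thesis
  proof (cases "even (t div n)")
    case True
    with * lt k show ?thesis by (intro that(1)[of "t mod n" "t div n"]) (auto simp: snake_def)
  next
    case False
    \<comment> \<open>In a reversed row the column of step \<open>Suc t\<close> is the smaller one
      and serves as \<open>i\<close>.\<close>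
    with * lt k show ?thesis
      by (intro that(1)[of "n - 1 - Suc (t mod n)" "t div n"]) (auto simp: snake_def)
  qed
qed

section \<open>The product with a path\<close>

theorem theorem3p6:
  fixes G :: "'a pair_pre_digraph" and k :: nat
  assumes "pair_graph G"
    and "Digraph_Component.connected (with_proj G)"
    and "bipartite G"
    and "card (pverts G) \<ge> 2"
    and "has_hamiltonian_path G"
    and "k \<ge> 2"
  shows "fools_solitaire_number (G \<box> path_graph k)
       = independence_number (G \<box> path_graph k) - 1"
proof -
  let ?H = "G \<box> path_graph k"
  interpret G: pair_graph G by fact
  have symG: "(v, u) \<in> parcs G" if "(u, v) \<in> parcs G" for u v
    using G.pair_sym_arcs that by (auto simp: symmetric_def sym_def)
  obtain p where "vpath p (with_proj G)" and p: "set p = pverts G"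
    using assms(5) by (auto simp: has_hamiltonian_path_def)
  then have "distinct p" and parc: "\<And>i. Suc i < length p \<Longrightarrow> (p ! i, p ! Suc i) \<in> parcs G"
    using vwalk_nth_arc[of p "with_proj G"] by (auto simp: vpath_def)
  define n where "n = length p"
  have n: "n \<ge> 2" using \<open>distinct p\<close> p assms(4) by (metis n_def distinct_card)
  obtain A B where AB: "pverts G = A \<union> B" "A \<inter> B = {}" "parcs G \<subseteq> A \<times> B \<union> B \<times> A"
    using assms(3) by (auto simp: bipartite_def)
  \<comment> \<open>The colouring of \<open>G\<close>, flipped in every odd layer, so that both
    kinds of product edges change it.\<close>
  define c where "c = (\<lambda>(g, j :: nat). g \<in> A \<longleftrightarrow> even j)"
  define e where "e = (\<lambda>(i, j :: nat). (p ! i, j))"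
  define q where "q = e \<circ> snake n"
  have vH: "pverts ?H = pverts G \<times> {..<k}"
    by (simp add: cart_prod_def path_graph_def)
  have bij_p: "bij_betw ((!) p) {..<n} (pverts G)"
    using bij_betw_nth[OF \<open>distinct p\<close>] p n_def by blast
  have bij_e: "bij_betw e ({..<n} \<times> {..<k}) (pverts ?H)"
    using bij_betw_map_prod[OF bij_p bij_betw_id] by (simp add: vH e_def map_prod_def id_def)
  have e_surj: "\<exists>i<n. \<exists>j<k. x = e (i, j)" if "x \<in> pverts ?H" for x
  proof -
    have "x \<in> e ` ({..<n} \<times> {..<k})" using that bij_betw_imp_surj_on[OF bij_e] by simp
    then show ?thesis by auto
  qed
  have harc: "(e (i, j), e (Suc i, j)) \<in> parcs ?H" "(e (Suc i, j), e (i, j)) \<in> parcs ?H"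
    if "Suc i < n" "j < k" for i j
    using parc[of i] symG that by (auto simp: e_def n_def cart_prod_def path_graph_def)
  have varc: "(e (i, j), e (i, Suc j)) \<in> parcs ?H" "(e (i, Suc j), e (i, j)) \<in> parcs ?H"
    if "i < n" "Suc j < k" for i j
    using that p nth_mem[of i p] by (auto simp: e_def n_def cart_prod_def path_graph_def)
  interpret bipartite_hamiltonian ?H c q "n * k"
  proof (rule bipartite_hamiltonian.intro)
    show "pair_graph ?H" by (rule pair_graph_cart_prod[OF assms(1) pair_graph_path_graph])
    show "c u \<noteq> c v" if "(u, v) \<in> parcs ?H" for u v
      using that AB by (auto simp: c_def cart_prod_def path_graph_def)
    show "bij_betw q {..<n * k} (pverts ?H)"
      unfolding q_def using snake_bij bij_e n by (intro bij_betw_trans) auto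
    show "(q t, q (Suc t)) \<in> parcs ?H" if "Suc t < n * k" for t
      using n that by (elim snake_step[rotated]) (auto simp: q_def harc varc doubleton_eq_iff)
  qed
  show ?thesis
  proof (rule fools_solitaire_number_eq)
    show "4 \<le> n * k" using mult_le_mono[OF n assms(6)] by simp
    have "q (n * k - 1) \<in> pverts ?H" using n assms(6) by (intro q_in) simp
    then obtain i j where ij: "i < n" "j < k" "q (n * k - 1) = e (i, j)"
      using e_surj by blast
    \<comment> \<open>The last vertex has a neighbour in each coordinate direction; these differ, so
      one of them is not its predecessor on the walk.\<close>
    obtain i' where i': "(e (i, j), e (i', j)) \<in> parcs ?H"
      using harc[of i j] harc[of "i - 1" j] ij n by (cases "Suc i < n") auto
    obtain j' where j': "(e (i, j), e (i, j')) \<in> parcs ?H"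
      using varc[of i j] varc[of i "j - 1"] ij assms(6) by (cases "Suc j < k") auto
    have "e (i', j) \<noteq> e (i, j')" using arc_neq[OF i'] by (auto simp: e_def)
    with i' j' ij show "\<exists>w. (q (n * k - 1), w) \<in> parcs ?H \<and> w \<noteq> q (n * k - 2)" by metis
  next
    fix T t
    assume "even (n * k)" and T: "independent_set ?H T" "2 * card T = n * k" and t: "Suc t < n * k"
    define P where "P i j \<longleftrightarrow> e (i, j) \<in> T" for i j
    have ind: "\<not> (u \<in> T \<and> v \<in> T)" if "(u, v) \<in> parcs ?H" for u v
      using that T(1) by (auto simp: independent_set_def)
    have h: "\<not> (P i j \<and> P (Suc i) j)" if "Suc i < n" "j < k" for i j
      unfolding P_def using ind[OF harc(1)[OF that]] .
    have v: "\<not> (P i j \<and> P i (Suc j))" if "i < n" "Suc j < k" for i j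
      unfolding P_def using ind[OF varc(1)[OF that]] .
    have Te: "\<exists>i<n. \<exists>j<k. x = e (i, j)" if "x \<in> T" for x
      using T(1) e_surj that unfolding independent_set_def by blast
    have "(\<forall>i j. Suc i < n \<longrightarrow> j < k \<longrightarrow> P i j \<longleftrightarrow> \<not> P (Suc i) j) \<and>
          (\<forall>i j. i < n \<longrightarrow> Suc j < k \<longrightarrow> P i j \<longleftrightarrow> \<not> P i (Suc j))"
    \<comment> \<open>An even side lets edges in that direction tile the grid by dominoes. There are
      as many dominoes as elements of \<open>T\<close>, so \<open>T\<close> meets each of
      them.\<close>
    proof (cases "even k")
      case True
      let ?I = "{..<n} \<times> {..<k div 2}"
      let ?f = "\<lambda>(i, j). e (i, 2 * j)" and ?g = "\<lambda>(i, j). e (i, 2 * j + 1)"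
      have "card T = card ?I" using T(2) True by (auto elim!: evenE)
      moreover have "T \<subseteq> (\<Union>x\<in>?I. {?f x, ?g x})"
      proof
        fix x assume "x \<in> T"
        then obtain i j where ij: "i < n" "j < k" "x = e (i, j)" using Te by blast
        obtain l where "l < k div 2" "j = 2 * l \<or> j = 2 * l + 1" using less_even_cases[OF ij(2) True] by blast
        then have "(i, l) \<in> ?I" "x = ?f (i, l) \<or> x = ?g (i, l)" using ij by auto
        then show "x \<in> (\<Union>x\<in>?I. {?f x, ?g x})" by blast
      qed
      moreover have "\<not> (?f x \<in> T \<and> ?g x \<in> T \<and> ?f x \<noteq> ?g x)" if "x \<in> ?I" for x
      proof -
        have "fst x < n" "Suc (2 * snd x) < k" using that by auto
        then show ?thesis using v[of "fst x" "2 * snd x"] by (auto simp: P_def split_beta)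
      qed
      ultimately have "?f (i, j) \<in> T \<or> ?g (i, j) \<in> T" if "i < n" "j < k div 2" for i j
        using that by (intro card_le_pairs(2)[of ?I]) auto
      then have "P i (2 * j) \<or> P i (2 * j + 1)" if "i < n" "j < k div 2" for i j
        using that by (simp add: P_def)
      from ladder_alternating[where P = P, OF h v this True n] show ?thesis by blast
    next
      case False
      \<comment> \<open>Now the dominoes lie in the other direction, and the ladder lemma is applied
        to the transposed grid.\<close>
      with \<open>even (n * k)\<close> have True: "even n" by simp
      let ?I = "{..<n div 2} \<times> {..<k}"
      let ?f = "\<lambda>(i, j). e (2 * i, j)" and ?g = "\<lambda>(i, j). e (2 * i + 1, j)"
      have "card T = card ?I" using T(2) True by (auto elim!: evenE)
      moreover have "T \<subseteq> (\<Union>x\<in>?I. {?f x, ?g x})"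
      proof
        fix x assume "x \<in> T"
        then obtain i j where ij: "i < n" "j < k" "x = e (i, j)" using Te by blast
        obtain l where "l < n div 2" "i = 2 * l \<or> i = 2 * l + 1" using less_even_cases[OF ij(1) True] by blast
        then have "(l, j) \<in> ?I" "x = ?f (l, j) \<or> x = ?g (l, j)" using ij by auto
        then show "x \<in> (\<Union>x\<in>?I. {?f x, ?g x})" by blast
      qed
      moreover have "\<not> (?f x \<in> T \<and> ?g x \<in> T \<and> ?f x \<noteq> ?g x)" if "x \<in> ?I" for x
      proof -
        have "Suc (2 * fst x) < n" "snd x < k" using that by auto
        then show ?thesis using h[of "2 * fst x" "snd x"] by (auto simp: P_def split_beta)
      qed
      ultimately have "?f (i, j) \<in> T \<or> ?g (i, j) \<in> T" if "i < n div 2" "j < k" for i j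
        using that by (intro card_le_pairs(2)[of ?I]) auto
      then have rung: "P (2 * i) j \<or> P (2 * i + 1) j" if "j < k" "i < n div 2" for i j
        using that by (simp add: P_def)
      have h': "\<not> (P i j \<and> P (Suc i) j)" if "j < k" "Suc i < n" for i j
        using h that by blast
      have v': "\<not> (P i j \<and> P i (Suc j))" if "Suc j < k" "i < n" for i j
        using v that by blast
      from ladder_alternating[where P = "\<lambda>j i. P i j", OF v' h' rung True assms(6)]
      show ?thesis by blast
    qed
    with t n show "q t \<in> T \<longleftrightarrow> q (Suc t) \<notin> T"
      by (elim snake_step[rotated]) (auto simp: q_def P_def doubleton_eq_iff)
  qed
qed

end
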